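(* Let $X$ be a non-negative, absolutely continuous, DMRD random variable with $\mathbb{E}X<+\infty$. Then: (i) for any $\alpha>0$ and $\beta\in\mathbb{R}$, the random variable $\alpha X+\beta$ is DMRD (i.e. the DMRD class is closed under positive scale transformations and shifting); (ii) for any $0<\alpha\le 1$, the random variable $X^{\alpha}$ is DMRD.
   Context: For a random variable $Z$ with continuous distribution function $F_Z$, tail $\bar F_Z:=1-F_Z$ and finite expectation, let $H_Z:=\inf\{p\in\mathbb{R}: F_Z(p)=1\}\le+\infty$. The mean residual demand (MRD) function of $Z$ is $\mathrm{m}_Z(p):=\mathbb{E}(Z-p\mid Z>p)=\frac{1}{\bar F_Z(p)}\int_p^{+\infty}\bar F_Z(u)\,du$ for $p<H_Z$ and $\mathrm{m}_Z(p):=0$ otherwise. $Z$ is DMRD (decreasing mean residual demand) if $\mathrm{m}_Z(p)$ is non-increasing in $p$ for $p<H_Z$. *)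

theory Defs
  imports "HOL-Probability.Probability"
begin

abbreviation rv_cdf :: "'a measure \<Rightarrow> ('a \<Rightarrow> real) \<Rightarrow> real \<Rightarrow> real" where
  "rv_cdf M Z \<equiv> cdf (distr M borel Z)"

definition tail :: "'a measure \<Rightarrow> ('a \<Rightarrow> real) \<Rightarrow> real \<Rightarrow> real" where
  "tail M Z p = 1 - rv_cdf M Z p"

(* The infimum is taken in ereal, so it is \<infinity> when F_Z never reaches 1. *)
definition upper_end :: "'a measure \<Rightarrow> ('a \<Rightarrow> real) \<Rightarrow> ereal" where
  "upper_end M Z = Inf (ereal ` {p. rv_cdf M Z p = 1})"

(* uniform_measure M A is M conditioned on the event A, so the integral below is
   E(Z - p | Z > p). Its expression as a normalized tail integral is mrd_eq_tail_integral. *)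
definition mrd :: "'a measure \<Rightarrow> ('a \<Rightarrow> real) \<Rightarrow> real \<Rightarrow> real" where
  "mrd M Z p =
    (if ereal p < upper_end M Z
     then LINT w|uniform_measure M {w \<in> space M. p < Z w}. (Z w - p)
     else 0)"

(* The MRD function is only considered for random variables with finite expectation and
   continuous distribution function, so these requirements are part of being DMRD. *)
definition dmrd :: "'a measure \<Rightarrow> ('a \<Rightarrow> real) \<Rightarrow> bool" where
  "dmrd M Z \<longleftrightarrow>
     integrable M Z \<and> continuous_on UNIV (rv_cdf M Z) \<and>
     antimono_on {p. ereal p < upper_end M Z} (mrd M Z)"

lemma (in prob_space) tail_eq_prob:
  assumes [measurable]: "random_variable borel Z"
  shows "tail M Z p = prob {w \<in> space M. p < Z w}"
proof -
  have "rv_cdf M Z p = prob {w \<in> space M. Z w \<le> p}"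
    unfolding cdf_def by (subst measure_distr) (auto intro!: arg_cong[where f = prob])
  moreover have "prob {w \<in> space M. \<not> Z w \<le> p} = 1 - prob {w \<in> space M. Z w \<le> p}"
    by (rule prob_neg) simp
  ultimately show ?thesis
    by (simp add: tail_def not_le)
qed

lemma (in prob_space) mrd_eq_tail_integral:
  assumes int: "integrable M Z" and p: "ereal p < upper_end M Z"
  shows "mrd M Z p = (LINT u:{p..}|lborel. tail M Z u) / tail M Z p"
proof -
  have [measurable]: "random_variable borel Z"
    using int by simp
  interpret D: real_distribution "distr M borel Z"
    by simp
  have cdf_meas [measurable]: "rv_cdf M Z \<in> borel_measurable borel"
    by (intro borel_measurable_mono monoI D.cdf_nondecreasing)
  have [measurable]: "tail M Z \<in> borel_measurable borel"
    unfolding tail_def[abs_def] by measurable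
  have tail_nonneg: "tail M Z u \<ge> 0" for u
    by (simp add: tail_eq_prob)
  let ?A = "{w \<in> space M. p < Z w}"
  have "rv_cdf M Z p \<noteq> 1"
    using p unfolding upper_end_def by (force simp: not_le[symmetric] intro: Inf_lower)
  then have pos: "prob ?A > 0"
    using tail_nonneg[of p] tail_eq_prob[of Z p] by (auto simp: tail_def less_le)
  have eA: "emeasure M ?A = ennreal (prob ?A)"
    by (simp add: emeasure_eq_measure)
  have dens: "indicator ?A w / emeasure M ?A = ennreal (indicator ?A w / prob ?A)" for w
    using pos by (cases "w \<in> ?A") (auto simp: eA divide_ennreal ennreal_1[symmetric] simp del: ennreal_1)
  have "(LINT w|uniform_measure M ?A. (Z w - p)) =
        (LINT w|density M (\<lambda>w. ennreal (indicator ?A w / prob ?A)). (Z w - p))"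
    unfolding uniform_measure_def dens ..
  also have "\<dots> = (LINT w|M. (indicator ?A w / prob ?A) *\<^sub>R (Z w - p))"
    using pos by (intro integral_density) auto
  also have "\<dots> = (LINT w|M. max 0 (Z w - p) / prob ?A)"
    by (rule Bochner_Integration.integral_cong) (auto simp: indicator_def)
  also have "\<dots> = (LINT w|M. max 0 (Z w - p)) / prob ?A"
    by simp
  also have "(LINT w|M. max 0 (Z w - p)) = (LINT u:{p..}|lborel. tail M Z u)"
  proof -
    have "(\<integral>\<^sup>+w. ennreal (max 0 (Z w - p)) \<partial>M) =
          (\<integral>\<^sup>+w. (\<integral>\<^sup>+u. indicator {p..<Z w} u \<partial>lborel) \<partial>M)"
      by (intro nn_integral_cong) (auto simp: max_def)
    also have "\<dots> = (\<integral>\<^sup>+w. (\<integral>\<^sup>+u. (if p \<le> u \<and> u < Z w then 1 else 0) \<partial>lborel) \<partial>M)"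
      by (intro nn_integral_cong) (auto simp: indicator_def)
    also have "\<dots> = (\<integral>\<^sup>+u. (\<integral>\<^sup>+w. (if p \<le> u \<and> u < Z w then 1 else 0) \<partial>M) \<partial>lborel)"
    proof -
      interpret P: pair_sigma_finite M lborel ..
      show ?thesis
        by (rule P.Fubini'[symmetric]) measurable
    qed
    also have "\<dots> = (\<integral>\<^sup>+u. ennreal (indicator {p..} u *\<^sub>R tail M Z u) \<partial>lborel)"
    proof (intro nn_integral_cong)
      fix u :: real
      have "(\<integral>\<^sup>+w. (if p \<le> u \<and> u < Z w then 1 else 0) \<partial>M) =
            (\<integral>\<^sup>+w. indicator {p..} u * indicator {w \<in> space M. u < Z w} w \<partial>M)"
        by (intro nn_integral_cong) (auto simp: indicator_def)
      also have "\<dots> = indicator {p..} u * emeasure M {w \<in> space M. u < Z w}"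
        by (subst nn_integral_cmult_indicator) auto
      also have "\<dots> = ennreal (indicator {p..} u *\<^sub>R tail M Z u)"
        by (auto simp: indicator_def tail_eq_prob emeasure_eq_measure)
      finally show "(\<integral>\<^sup>+w. (if p \<le> u \<and> u < Z w then 1 else 0) \<partial>M) =
            ennreal (indicator {p..} u *\<^sub>R tail M Z u)" .
    qed
    finally have eq: "(\<integral>\<^sup>+w. ennreal (max 0 (Z w - p)) \<partial>M) =
        (\<integral>\<^sup>+u. ennreal (indicator {p..} u *\<^sub>R tail M Z u) \<partial>lborel)" .
    have "(LINT w|M. max 0 (Z w - p)) = enn2real (\<integral>\<^sup>+w. ennreal (max 0 (Z w - p)) \<partial>M)"
      by (intro integral_eq_nn_integral) auto
    also have "\<dots> = (LINT u:{p..}|lborel. tail M Z u)"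
      unfolding eq set_lebesgue_integral_def
      by (intro integral_eq_nn_integral[symmetric]) (auto simp: tail_nonneg)
    finally show ?thesis .
  qed
  finally show ?thesis
    using p by (simp add: mrd_def tail_eq_prob)
qed

end

theory Submission
  imports Defs
begin

text \<open>
  Both parts are instances of one closure property: if \<open>X \<ge> 0\<close> is DMRD and \<open>\<phi>\<close> is
  concave, continuous and strictly increasing on \<open>[0, \<infinity>)\<close>, then \<open>\<phi>(X)\<close> is DMRD.

  Write \<open>m\<^sub>Z(p) = E(Z - p)\<^sup>+ / P(Z > p)\<close>. Let \<open>0 \<le> p < q\<close> and let \<open>c \<ge> 0\<close> be the slope of a line
  that supports the graph of \<open>\<phi>\<close> from above at \<open>q\<close>. By concavity \<open>\<phi>\<close> grows at least with slope \<open>c\<close>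
  up to \<open>q\<close> and at most with slope \<open>c\<close> beyond \<open>q\<close>, so that
  \<open>E(\<phi>(X) - \<phi>(p))\<^sup>+ \<ge> c (E(X - p)\<^sup>+ - E(X - q)\<^sup>+) + N\<close> and \<open>N \<le> c E(X - q)\<^sup>+\<close>, where
  \<open>N = E(\<phi>(X) - \<phi>(q))\<^sup>+\<close>. As \<open>X\<close> is DMRD,
  \<open>(E(X - p)\<^sup>+ - E(X - q)\<^sup>+) P(X > q) \<ge> E(X - q)\<^sup>+ (P(X > p) - P(X > q))\<close>; multiplying by \<open>c\<close>
  and inserting the two bounds gives \<open>E(\<phi>(X) - \<phi>(p))\<^sup>+ P(X > q) \<ge> N P(X > p)\<close>, which is the
  monotonicity of the mean residual demand of \<open>\<phi>(X)\<close> between the levels \<open>\<phi>(p)\<close> and \<open>\<phi>(q)\<close>.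
  Levels below \<open>\<phi>(0)\<close> are exceeded almost surely, so there the mean residual demand at \<open>r\<close> is
  \<open>E(\<phi>(X)) - r\<close>, which is decreasing in \<open>r\<close>.
\<close>

section \<open>Mean residual demand as a quotient\<close>

context prob_space
begin

text \<open>A level lies below the upper end point exactly when it is exceeded with positive
  probability; one direction uses that distribution functions are right-continuous.\<close>

lemma less_upper_end_iff:
  assumes Z: "random_variable borel Z"
  shows "ereal p < upper_end M Z \<longleftrightarrow> 0 < prob {w \<in> space M. p < Z w}"
proof -
  interpret D: real_distribution "distr M borel Z"
    using Z by simp
  have tail: "tail M Z p = prob {w \<in> space M. p < Z w}"
    by (rule tail_eq_prob[OF Z])
  have "upper_end M Z \<le> ereal p \<longleftrightarrow> rv_cdf M Z p = 1"
  proof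
    assume "rv_cdf M Z p = 1"
    then show "upper_end M Z \<le> ereal p"
      unfolding upper_end_def by (intro Inf_lower) auto
  next
    assume le: "upper_end M Z \<le> ereal p"
    have "rv_cdf M Z u = 1" if "p < u" for u
    proof -
      from le that have "upper_end M Z < ereal u"
        by (simp add: le_less_trans)
      then obtain v where "rv_cdf M Z v = 1" "v < u"
        unfolding upper_end_def Inf_less_iff by auto
      then show ?thesis
        using D.cdf_nondecreasing[of v u] D.cdf_bounded_prob[of u] by simp
    qed
    then have "((rv_cdf M Z) \<longlongrightarrow> 1) (at_right p)"
      by (intro tendsto_eventually) (auto simp: eventually_at_filter)
    moreover have "((rv_cdf M Z) \<longlongrightarrow> rv_cdf M Z p) (at_right p)"
      using D.cdf_is_right_cont by (simp add: continuous_within)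
    ultimately show "rv_cdf M Z p = 1"
      using tendsto_unique trivial_limit_at_right_real by blast
  qed
  moreover have "rv_cdf M Z p \<le> 1"
    by (rule D.cdf_bounded_prob)
  ultimately show ?thesis
    using tail by (auto simp: tail_def not_le[symmetric])
qed

lemma mrd_eq_quotient:
  assumes int: "integrable M Z" and pos: "0 < prob {w \<in> space M. p < Z w}"
  shows "mrd M Z p = expectation (\<lambda>w. max 0 (Z w - p)) / prob {w \<in> space M. p < Z w}"
proof -
  have [measurable]: "random_variable borel Z"
    using int by simp
  let ?A = "{w \<in> space M. p < Z w}"
  have eA: "emeasure M ?A = ennreal (prob ?A)"
    by (simp add: emeasure_eq_measure)
  have dens: "indicator ?A w / emeasure M ?A = ennreal (indicator ?A w / prob ?A)" for w
    using pos by (cases "w \<in> ?A")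
      (auto simp: eA divide_ennreal ennreal_1[symmetric] simp del: ennreal_1)
  have "(LINT w|uniform_measure M ?A. (Z w - p)) =
        (LINT w|density M (\<lambda>w. ennreal (indicator ?A w / prob ?A)). (Z w - p))"
    unfolding uniform_measure_def dens ..
  also have "\<dots> = (LINT w|M. (indicator ?A w / prob ?A) *\<^sub>R (Z w - p))"
    using pos by (intro integral_density) auto
  also have "\<dots> = (LINT w|M. max 0 (Z w - p) / prob ?A)"
    by (rule Bochner_Integration.integral_cong) (auto simp: indicator_def)
  finally show ?thesis
    using pos by (simp add: mrd_def less_upper_end_iff)
qed

lemma prob_greater_mono:
  fixes Z :: "'a \<Rightarrow> real"
  assumes [measurable]: "random_variable borel Z" and "p \<le> q"
  shows "prob {w \<in> space M. q < Z w} \<le> prob {w \<in> space M. p < Z w}"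
  using assms(2) by (intro finite_measure_mono) auto

text \<open>The DMRD property with the quotients cleared of denominators. If \<open>q\<close> is at or above the upper
  end point, both sides vanish, so no restriction on the levels is needed.\<close>

lemma dmrd_cross_mult:
  assumes "dmrd M Z" and "p \<le> q"
  shows "expectation (\<lambda>w. max 0 (Z w - q)) * prob {w \<in> space M. p < Z w}
       \<le> expectation (\<lambda>w. max 0 (Z w - p)) * prob {w \<in> space M. q < Z w}"
proof (cases "0 < prob {w \<in> space M. q < Z w}")
  case True
  have int: "integrable M Z" and Z: "random_variable borel Z"
    using assms(1) by (auto simp: dmrd_def)
  have pos: "0 < prob {w \<in> space M. p < Z w}"
    using True prob_greater_mono[OF Z assms(2)] by linarith
  have "mrd M Z q \<le> mrd M Z p"
    using assms True pos by (auto simp: dmrd_def less_upper_end_iff[OF Z] monotone_on_def)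
  then show ?thesis
    using True pos by (simp add: mrd_eq_quotient[OF int] divide_simps mult.commute)
next
  case False
  then have 0: "prob {w \<in> space M. q < Z w} = 0"
    using measure_nonneg[of M] by (simp add: less_le)
  have [measurable]: "random_variable borel Z"
    using assms(1) by (auto simp: dmrd_def)
  have "AE w in M. \<not> q < Z w"
    using 0 prob_eq_0[of "{w \<in> space M. q < Z w}"] by auto
  then have "expectation (\<lambda>w. max 0 (Z w - q)) = 0"
    by (intro integral_eq_zero_AE) (auto simp: max_def)
  then show ?thesis
    using 0 by simp
qed

text \<open>Continuity of the distribution function is expressed by the absence of atoms.\<close>

lemma dmrdI:
  assumes int: "integrable M Z"
    and cont: "\<And>y. prob {w \<in> space M. Z w = y} = 0"
    and mono: "\<And>p q. p \<le> q \<Longrightarrow> 0 < prob {w \<in> space M. q < Z w} \<Longrightarrow>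
      expectation (\<lambda>w. max 0 (Z w - q)) * prob {w \<in> space M. p < Z w}
       \<le> expectation (\<lambda>w. max 0 (Z w - p)) * prob {w \<in> space M. q < Z w}"
  shows "dmrd M Z"
proof -
  have Z [measurable]: "random_variable borel Z"
    using int by simp
  interpret D: real_distribution "distr M borel Z"
    by simp
  have "measure (distr M borel Z) {y} = 0" for y
    using cont[of y] by (subst measure_distr) (auto simp: vimage_def Int_def conj_commute)
  then have "continuous_on UNIV (rv_cdf M Z)"
    by (simp add: continuous_on_eq_continuous_at D.isCont_cdf)
  moreover have "mrd M Z q \<le> mrd M Z p"
    if "p \<le> q" "0 < prob {w \<in> space M. p < Z w}" "0 < prob {w \<in> space M. q < Z w}" for p q
    using that mono[of p q] by (simp add: mrd_eq_quotient[OF int] divide_simps mult.commute)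
  ultimately show ?thesis
    using int by (auto simp: dmrd_def less_upper_end_iff[OF Z] monotone_on_def)
qed

lemma dmrd_imp_prob_eq_0:
  assumes "dmrd M Z"
  shows "prob {w \<in> space M. Z w = y} = 0"
proof -
  have [measurable]: "random_variable borel Z"
    using assms by (auto simp: dmrd_def)
  interpret D: real_distribution "distr M borel Z"
    by simp
  have "measure (distr M borel Z) {y} = 0"
    using assms by (simp add: dmrd_def continuous_on_eq_continuous_at D.isCont_cdf)
  then show ?thesis
    by (subst (asm) measure_distr) (auto simp: vimage_def Int_def conj_commute)
qed

end

section \<open>Concave functions on the half-line\<close>

lemma concave_on_supporting_line:
  fixes f :: "real \<Rightarrow> real"
  assumes conc: "concave_on {0..} f" and mono: "strict_mono_on {0..} f" and q: "0 < q"
  obtains c where "0 \<le> c" and "\<And>x. 0 \<le> x \<Longrightarrow> f x \<le> f q + c * (x - q)"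
proof -
  define c where "c = - Inf ((\<lambda>t. ((- f q) - (- f t)) / (q - t)) ` ({q<..} \<inter> {0..}))"
  have "f x \<le> f q + c * (x - q)" if "0 \<le> x" for x
    using convex_le_Inf_differential[of "{0..}" "\<lambda>x. - f x" q x] conc q that
    by (simp add: concave_on_def c_def)
  moreover from this[of "q + 1"] have "0 \<le> c"
    using strict_mono_onD[OF mono, of q "q + 1"] q by auto
  ultimately show thesis
    using that by blast
qed

lemma concave_powr:
  fixes \<alpha> :: real
  assumes \<alpha>: "0 < \<alpha>" "\<alpha> \<le> 1"
  shows "concave_on {0..} (\<lambda>x::real. x powr \<alpha>)"
proof (rule concave_on_linorderI)
  fix t x y :: real
  assume t: "0 < t" "t < 1" and xy: "x \<in> {0..}" "y \<in> {0..}" "x < y"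
  show "(1 - t) * x powr \<alpha> + t * y powr \<alpha> \<le> ((1 - t) *\<^sub>R x + t *\<^sub>R y) powr \<alpha>"
  proof (cases "x = 0")
    case True
    have "t \<le> t powr \<alpha>"
      using powr_mono'[of \<alpha> 1 t] t \<alpha> by simp
    then show ?thesis
      using True t xy \<alpha> by (simp add: powr_mult mult_right_mono)
  next
    case False
    \<comment> \<open>The inverse function is the convex power \<open>1 / \<alpha> \<ge> 1\<close>.\<close>
    with xy have pos: "0 < x" "0 < y" by auto
    let ?s = "(1 - t) * x powr \<alpha> + t * y powr \<alpha>"
    have "?s powr (1 / \<alpha>) \<le> (1 - t) * (x powr \<alpha>) powr (1 / \<alpha>) + t * (y powr \<alpha>) powr (1 / \<alpha>)"
      using convex_onD[OF powr_convex[of "1 / \<alpha>"], of t "x powr \<alpha>" "y powr \<alpha>"] t \<alpha> pos by simp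
    also have "\<dots> = (1 - t) * x + t * y"
      using \<alpha> pos by (simp add: powr_powr)
    finally have "(?s powr (1 / \<alpha>)) powr \<alpha> \<le> ((1 - t) * x + t * y) powr \<alpha>"
      using \<alpha> by (intro powr_mono2) auto
    moreover have "(?s powr (1 / \<alpha>)) powr \<alpha> = ?s"
      using \<alpha> t by (simp add: powr_powr)
    ultimately show ?thesis
      by simp
  qed
qed simp

section \<open>Increasing concave transformations\<close>

context prob_space
begin

context
  fixes X :: "'a \<Rightarrow> real" and \<phi> :: "real \<Rightarrow> real"
  assumes nonneg: "AE w in M. 0 \<le> X w"
    and dmrd: "dmrd M X"
    and meas [measurable]: "\<phi> \<in> borel_measurable borel"
    and conc: "concave_on {0..} \<phi>"
    and cont: "continuous_on {0..} \<phi>"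
    and mono: "strict_mono_on {0..} \<phi>"
begin

lemma integrable_X: "integrable M X"
  using dmrd by (simp add: dmrd_def)

lemma measurable_X [measurable]: "random_variable borel X"
  using integrable_X by simp

lemma less_iff: "0 \<le> x \<Longrightarrow> 0 \<le> y \<Longrightarrow> \<phi> x < \<phi> y \<longleftrightarrow> x < y"
  using strict_mono_on_less[OF mono] by auto

lemma le_iff: "0 \<le> x \<Longrightarrow> 0 \<le> y \<Longrightarrow> \<phi> x \<le> \<phi> y \<longleftrightarrow> x \<le> y"
  using strict_mono_on_less_eq[OF mono] by auto

lemma integrable_transform: "integrable M (\<lambda>w. \<phi> (X w))"
proof -
  obtain c where c: "0 \<le> c" "\<And>x. 0 \<le> x \<Longrightarrow> \<phi> x \<le> \<phi> 1 + c * (x - 1)"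
    using concave_on_supporting_line[OF conc mono, of 1] by auto
  have int: "integrable M (\<lambda>w. \<bar>\<phi> 0\<bar> + \<bar>\<phi> 1 + c * (X w - 1)\<bar>)"
    using integrable_X by auto
  have "\<bar>\<phi> x\<bar> \<le> \<bar>\<phi> 0\<bar> + \<bar>\<phi> 1 + c * (x - 1)\<bar>" if "0 \<le> x" for x
    using c(2)[OF that] le_iff[of 0 x] that by auto
  then have "AE w in M. norm (\<phi> (X w)) \<le> norm (\<bar>\<phi> 0\<bar> + \<bar>\<phi> 1 + c * (X w - 1)\<bar>)"
    using nonneg by auto
  then show ?thesis
    by (intro Bochner_Integration.integrable_bound[OF int]) auto
qed

lemma integrable_excess_transform: "integrable M (\<lambda>w. max 0 (\<phi> (X w) - r))"
  using integrable_transform by auto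

lemma integrable_excess: "integrable M (\<lambda>w. max 0 (X w - r))"
  using integrable_X by auto

lemma prob_transform_greater:
  assumes "0 \<le> p"
  shows "prob {w \<in> space M. \<phi> p < \<phi> (X w)} = prob {w \<in> space M. p < X w}"
  by (rule finite_measure_eq_AE) (use nonneg assms in \<open>auto simp: less_iff\<close>)

lemma prob_transform_greater_eq_1:
  assumes "r \<le> \<phi> 0"
  shows "prob {w \<in> space M. r < \<phi> (X w)} = 1"
proof -
  have "AE w in M. X w \<noteq> 0"
    using dmrd_imp_prob_eq_0[OF dmrd, of 0] prob_eq_0[of "{w \<in> space M. X w = 0}"] by auto
  with nonneg have "AE w in M. r < \<phi> (X w)"
    by eventually_elim (use assms less_iff[of 0] in fastforce)
  then show ?thesis
    by (subst prob_Collect_eq_1) auto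
qed

lemma prob_transform_eq: "prob {w \<in> space M. \<phi> (X w) = y} = 0"
proof (cases "\<exists>x\<ge>0. \<phi> x = y")
  case True
  then obtain x where x: "0 \<le> x" "\<phi> x = y" by auto
  have inj: "\<phi> z = y \<longleftrightarrow> z = x" if "0 \<le> z" for z
    using le_iff[of x z] le_iff[of z x] x that by (metis order_antisym order_refl)
  have "AE w in M. \<phi> (X w) = y \<longleftrightarrow> X w = x"
    using nonneg by eventually_elim (rule inj)
  then have "prob {w \<in> space M. \<phi> (X w) = y} = prob {w \<in> space M. X w = x}"
    by (intro finite_measure_eq_AE) auto
  then show ?thesis
    using dmrd_imp_prob_eq_0[OF dmrd] by simp
next
  case False
  have "AE w in M. \<phi> (X w) \<noteq> y"
    using nonneg by eventually_elim (use False in auto)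
  then show ?thesis
    by (subst prob_eq_0) auto
qed

text \<open>The estimate at the core of the argument: \<open>upper\<close> and \<open>lower\<close> compare \<open>\<phi>\<close> pointwise with its
  supporting line at \<open>q\<close>, and their expectations are combined with the DMRD inequality for \<open>X\<close>.\<close>

lemma transform_cross_mult:
  assumes p: "0 \<le> p" and pq: "p < q"
  shows "expectation (\<lambda>w. max 0 (\<phi> (X w) - \<phi> q)) * prob {w \<in> space M. p < X w}
       \<le> expectation (\<lambda>w. max 0 (\<phi> (X w) - \<phi> p)) * prob {w \<in> space M. q < X w}"
    (is "?N * ?Tp \<le> ?P * ?Tq")
proof -
  obtain c where c: "0 \<le> c" "\<And>x. 0 \<le> x \<Longrightarrow> \<phi> x \<le> \<phi> q + c * (x - q)"
    using concave_on_supporting_line[OF conc mono, of q] p pq by auto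
  let ?Gp = "expectation (\<lambda>w. max 0 (X w - p))"
  let ?Gq = "expectation (\<lambda>w. max 0 (X w - q))"
  have upper: "max 0 (\<phi> x - \<phi> q) \<le> c * max 0 (x - q)" if x: "0 \<le> x" for x
    using c(1) c(2)[OF x] le_iff[of x q] x p pq by (auto simp: max_def)
  have lower: "c * (max 0 (x - p) - max 0 (x - q)) + max 0 (\<phi> x - \<phi> q) \<le> max 0 (\<phi> x - \<phi> p)"
    if x: "0 \<le> x" for x
  proof -
    have slope: "c * (q - p) \<le> \<phi> q - \<phi> p"
      using c(2)[OF p] by (simp add: algebra_simps)
    consider "x \<le> p" | "p < x" "x \<le> q" | "q < x" by linarith
    then show ?thesis
    proof cases
      case 1
      then show ?thesis
        using le_iff[of x q] x p pq by (auto simp: max_def)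
    next
      case 2
      define t where "t = (x - p) / (q - p)"
      have t: "0 \<le> t" "t \<le> 1" and tx: "t * (q - p) = x - p"
        using 2 pq by (auto simp: t_def)
      have xt: "(1 - t) *\<^sub>R p + t *\<^sub>R q = x"
        using tx by (simp add: algebra_simps)
      \<comment> \<open>On \<open>[p, q]\<close> the graph lies above its chord, whose slope is at least \<open>c\<close>.\<close>
      have "(1 - t) * \<phi> p + t * \<phi> q \<le> \<phi> x"
        using concave_onD[OF conc t, of p q] p pq unfolding xt by simp
      then have "t * (\<phi> q - \<phi> p) \<le> \<phi> x - \<phi> p"
        by (simp add: algebra_simps)
      moreover have "t * (c * (q - p)) \<le> t * (\<phi> q - \<phi> p)"
        using t slope by (intro mult_left_mono) auto
      moreover have "t * (c * (q - p)) = c * (x - p)"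
        by (simp add: tx[symmetric])
      ultimately have "c * (x - p) \<le> \<phi> x - \<phi> p"
        by linarith
      then show ?thesis
        using le_iff[of x q] le_iff[of p x] 2 x p pq by (auto simp: max_def)
    next
      case 3
      then show ?thesis
        using slope le_iff[of q x] le_iff[of p x] x p pq by (auto simp: max_def)
    qed
  qed
  note [simp] = integrable_excess integrable_excess_transform
  have "?N \<le> expectation (\<lambda>w. c * max 0 (X w - q))"
    by (intro integral_mono_AE) (use nonneg upper in auto)
  then have N: "?N \<le> c * ?Gq"
    by simp
  have "expectation (\<lambda>w. c * (max 0 (X w - p) - max 0 (X w - q)) + max 0 (\<phi> (X w) - \<phi> q)) \<le> ?P"
    by (intro integral_mono_AE) (use nonneg lower in auto)
  then have P: "c * (?Gp - ?Gq) + ?N \<le> ?P"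
    by simp
  have T: "?Tq \<le> ?Tp"
    using pq by (intro prob_greater_mono) auto
  have "?Gq * (?Tp - ?Tq) \<le> (?Gp - ?Gq) * ?Tq"
    using dmrd_cross_mult[OF dmrd, of p q] pq by (simp add: algebra_simps)
  then have "c * (?Gq * (?Tp - ?Tq)) \<le> c * ((?Gp - ?Gq) * ?Tq)"
    using c(1) by (rule mult_left_mono)
  moreover have "?N * (?Tp - ?Tq) \<le> c * ?Gq * (?Tp - ?Tq)"
    using N T by (intro mult_right_mono) auto
  moreover have "(c * (?Gp - ?Gq) + ?N) * ?Tq \<le> ?P * ?Tq"
    using P by (intro mult_right_mono) auto
  ultimately show ?thesis
    by (simp add: algebra_simps)
qed

lemma dmrd_concave_transform: "dmrd M (\<lambda>w. \<phi> (X w))"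
proof (rule dmrdI)
  fix r s :: real
  assume rs: "r \<le> s" and pos: "0 < prob {w \<in> space M. s < \<phi> (X w)}"
  define E where "E = (\<lambda>r. expectation (\<lambda>w. max 0 (\<phi> (X w) - r)))"
  define T where "T = (\<lambda>r. prob {w \<in> space M. r < \<phi> (X w)})"
  have E_mono: "E b \<le> E a" if "a \<le> b" for a b
    unfolding E_def using that
    by (intro integral_mono integrable_excess_transform) auto
  have T_1: "T a = 1" if "a \<le> \<phi> 0" for a
    unfolding T_def using that by (rule prob_transform_greater_eq_1)
  have "E s * T r \<le> E r * T s"
  proof (cases "s \<le> \<phi> 0")
    case True
    then show ?thesis
      using rs E_mono[of r s] T_1[of r] T_1[of s] by simp
  next
    case False
    have "\<exists>x\<ge>0. s < \<phi> x"
    proof (rule ccontr)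
      assume "\<not> ?thesis"
      then have "AE w in M. \<not> s < \<phi> (X w)"
        using nonneg by auto
      then have "prob {w \<in> space M. s < \<phi> (X w)} = 0"
        by (subst prob_eq_0) auto
      then show False
        using pos by simp
    qed
    then obtain b where b: "0 \<le> b" "s < \<phi> b" by auto
    \<comment> \<open>Continuity of \<open>\<phi>\<close> turns levels of \<open>\<phi>(X)\<close> into levels of \<open>X\<close>.\<close>
    have attained: "\<exists>x\<ge>0. \<phi> x = u" if "\<phi> 0 \<le> u" "u \<le> s" for u
      using IVT'[of \<phi> 0 u b] that b continuous_on_subset[OF cont] by fastforce
    obtain q where q: "0 \<le> q" "\<phi> q = s"
      using attained[of s] False by auto
    \<comment> \<open>A level \<open>r\<close> below \<open>\<phi> 0\<close> is first raised to \<open>\<phi> 0\<close>: this does not change \<open>T\<close>.\<close>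
    obtain p where p: "0 \<le> p" "\<phi> p = max r (\<phi> 0)"
      using attained[of "max r (\<phi> 0)"] False rs by auto
    have "p \<le> q"
      using le_iff[of p q] p q False rs by auto
    then have "E (\<phi> q) * T (\<phi> p) \<le> E (\<phi> p) * T (\<phi> q)"
      using transform_cross_mult[of p q] p(1) q(1)
      by (cases "p = q") (auto simp: E_def T_def prob_transform_greater)
    moreover have "T (\<phi> p) = T r"
      using T_1[of r] T_1[of "\<phi> 0"] p(2) by (auto simp: max_def)
    moreover have "E (\<phi> p) * T s \<le> E r * T s"
      using p(2) by (intro mult_right_mono E_mono) (auto simp: T_def)
    ultimately show ?thesis
      using q(2) by simp
  qed
  then show "expectation (\<lambda>w. max 0 (\<phi> (X w) - s)) * prob {w \<in> space M. r < \<phi> (X w)}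
    \<le> expectation (\<lambda>w. max 0 (\<phi> (X w) - r)) * prob {w \<in> space M. s < \<phi> (X w)}"
    by (simp add: E_def T_def)
qed (auto intro: integrable_transform prob_transform_eq)

end

end

section \<open>Affine maps and powers\<close>

theorem corollary4p2:
  fixes M :: "'a measure" and X :: "'a \<Rightarrow> real"
  assumes "prob_space M"
    and "X \<in> borel_measurable M"
    and "AE w in M. 0 \<le> X w"
    and "absolutely_continuous lborel (distr M borel X)"
    and "integrable M X"
    and "dmrd M X"
  shows "(\<forall>\<alpha> \<beta> :: real. 0 < \<alpha> \<longrightarrow> dmrd M (\<lambda>w. \<alpha> * X w + \<beta>)) \<and>
    (\<forall>\<alpha> :: real. 0 < \<alpha> \<and> \<alpha> \<le> 1 \<longrightarrow> dmrd M (\<lambda>w. X w powr \<alpha>))"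
proof (intro conjI allI impI)
  interpret prob_space M by fact
  fix \<alpha> \<beta> :: real
  assume "0 < \<alpha>"
  show "dmrd M (\<lambda>w. \<alpha> * X w + \<beta>)"
  proof (rule dmrd_concave_transform[OF assms(3,6), of "\<lambda>x. \<alpha> * x + \<beta>"])
    show "concave_on {0..} (\<lambda>x. \<alpha> * x + \<beta>)"
      unfolding concave_on_iff
    proof (intro conjI ballI allI impI)
      fix x y u v :: real
      assume "u + v = 1"
      then have "\<beta> = u * \<beta> + v * \<beta>"
        by (simp flip: distrib_right)
      then show "u * (\<alpha> * x + \<beta>) + v * (\<alpha> * y + \<beta>) \<le> \<alpha> * (u *\<^sub>R x + v *\<^sub>R y) + \<beta>"
        by (simp add: algebra_simps)
    qed simp
    show "strict_mono_on {0..} (\<lambda>x. \<alpha> * x + \<beta>)"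
      using \<open>0 < \<alpha>\<close> by (auto simp: strict_mono_on_def)
  qed (auto intro!: continuous_intros)
next
  interpret prob_space M by fact
  fix \<alpha> :: real
  assume \<alpha>: "0 < \<alpha> \<and> \<alpha> \<le> 1"
  show "dmrd M (\<lambda>w. X w powr \<alpha>)"
  proof (rule dmrd_concave_transform[OF assms(3,6), of "\<lambda>x. x powr \<alpha>"])
    show "concave_on {0..} (\<lambda>x::real. x powr \<alpha>)"
      using \<alpha> by (intro concave_powr) auto
    show "continuous_on {0..} (\<lambda>x::real. x powr \<alpha>)"
      using \<alpha> by (intro continuous_on_powr' continuous_intros) auto
    show "strict_mono_on {0..} (\<lambda>x::real. x powr \<alpha>)"
      using \<alpha> by (auto intro!: strict_mono_onI powr_less_mono2)
  qed measurable
qed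

end
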